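(* Let $d\ge2$ and $n\ge1$ be integers and let $\mu$ be a probability distribution on the symmetric group $S_d$ whose single ball transition matrix is irreducible. For $t\ge0$, let $d_{\mathrm{bal}}(t)$ and $d_{\mathrm{lab}}(t)$ denote the worst case total variation distance from stationarity at time $t$ for the $(d,n,\mu)$ balanced and labeled generalised Bernoulli--Laplace chains, respectively. Then $$d_{\mathrm{bal}}(t)=d_{\mathrm{lab}}(t)\quad\text{for all } t\ge0.$$
   Context: Single ball transition matrix: $U(i,j)=\mathbb P_{\sigma\sim\mu}(\sigma(i)=j)$ for $i,j\in[d]=\{1,\dots,d\}$. Labeled chain with parameters $(d,n,\mu)$: $d$ urns and $dn$ distinguishable balls labeled $1,\dots,dn$, with $n$ balls in each urn; a state records which balls are in which urn (no order within urns). In continuous time, at rate $1$, one ball is chosen uniformly at random from each urn, $\sigma\sim\mu$ is sampled, and the ball chosen from urn $i$ is moved to urn $\sigma(i)$ for every $i\in[d]$ (all choices independent). Its stationary distribution $\pi_{\mathrm{lab}}$ is the uniform distribution on the state space. Balanced chain with parameters $(d,n,\mu)$: the same dynamics, but each ball has one of $d$ colours, with exactly $n$ balls of each colour, balls of the same colour being indistinguishable; a state records the number of balls of each colour in each urn, each urn containing $n$ balls. Its stationary distribution $\pi_{\mathrm{bal}}$ is the image of the uniform distribution on labeled configurations under colouring the labels with $n$ labels per colour. The worst case total variation distance is $\max_x\|\mathbb P(X_t\in\cdot\mid X_0=x)-\pi\|_{\mathrm{TV}}$, the maximum being over all states of the respective chain and $\pi$ its stationary distribution above. *)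

theory Defs
  imports "HOL-Probability.Probability" "HOL-Combinatorics.Combinatorics"
begin

section \<open>The single ball transition matrix\<close>

definition single_ball_matrix :: "(nat \<Rightarrow> nat) pmf \<Rightarrow> nat \<Rightarrow> nat \<Rightarrow> real" where
  "single_ball_matrix \<mu> i j = measure_pmf.prob \<mu> {\<sigma>. \<sigma> i = j}"

text \<open>Matrices with index set \<open>{1..d}\<close> are functions of two indices; values at other
  indices are irrelevant.\<close>

primrec matrix_power :: "nat \<Rightarrow> (nat \<Rightarrow> nat \<Rightarrow> real) \<Rightarrow> nat \<Rightarrow> nat \<Rightarrow> nat \<Rightarrow> real" where
  "matrix_power d U 0 = (\<lambda>i j. if i = j then 1 else 0)"
| "matrix_power d U (Suc k) = (\<lambda>i j. \<Sum>l\<in>{1..d}. matrix_power d U k i l * U l j)"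

definition irreducible_matrix :: "nat \<Rightarrow> (nat \<Rightarrow> nat \<Rightarrow> real) \<Rightarrow> bool" where
  "irreducible_matrix d U \<longleftrightarrow> (\<forall>i\<in>{1..d}. \<forall>j\<in>{1..d}. \<exists>k. matrix_power d U k i j > 0)"


section \<open>Continuous-time chains and distance from stationarity\<close>

primrec chain_steps :: "('s \<Rightarrow> 's pmf) \<Rightarrow> nat \<Rightarrow> 's \<Rightarrow> 's pmf" where
  "chain_steps K 0 x = return_pmf x"
| "chain_steps K (Suc k) x = chain_steps K k x \<bind> K"

text \<open>Number of points of a rate 1 Poisson process in \<open>[0, t]\<close>. The library's Poisson
  distribution is only specified for positive rates.\<close>

definition num_jumps :: "real \<Rightarrow> nat pmf" where
  "num_jumps t = (if t = 0 then return_pmf 0 else poisson_pmf t)"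

text \<open>The law at time \<open>t\<close>, started at \<open>x\<close>, of the chain that makes a step according to \<open>K\<close> at
  each point of a rate 1 Poisson process; only meaningful for \<open>t \<ge> 0\<close>.\<close>

definition chain_law :: "('s \<Rightarrow> 's pmf) \<Rightarrow> real \<Rightarrow> 's \<Rightarrow> 's pmf" where
  "chain_law K t x = num_jumps t \<bind> (\<lambda>k. chain_steps K k x)"

definition tv_dist :: "'s pmf \<Rightarrow> 's pmf \<Rightarrow> real" where
  "tv_dist p q = (SUP A. \<bar>measure_pmf.prob p A - measure_pmf.prob q A\<bar>)"

definition worst_case_tv :: "'s set \<Rightarrow> ('s \<Rightarrow> 's pmf) \<Rightarrow> 's pmf \<Rightarrow> real \<Rightarrow> real" where
  "worst_case_tv S K \<pi> t = Max ((\<lambda>x. tv_dist (chain_law K t x) \<pi>) ` S)"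


section \<open>The labeled chain\<close>

text \<open>A state maps each of the balls \<open>{1..d * n}\<close> to the urn containing it.\<close>

definition urn :: "nat \<Rightarrow> nat \<Rightarrow> (nat \<Rightarrow> nat) \<Rightarrow> nat \<Rightarrow> nat set" where
  "urn d n x i = {b \<in> {1..d * n}. x b = i}"

definition labeled_states :: "nat \<Rightarrow> nat \<Rightarrow> (nat \<Rightarrow> nat) set" where
  "labeled_states d n =
     {x \<in> {1..d * n} \<rightarrow>\<^sub>E {1..d}. \<forall>i\<in>{1..d}. card (urn d n x i) = n}"

definition labeled_step ::
    "nat \<Rightarrow> nat \<Rightarrow> (nat \<Rightarrow> nat) pmf \<Rightarrow> (nat \<Rightarrow> nat) \<Rightarrow> (nat \<Rightarrow> nat) pmf" where
  "labeled_step d n \<mu> x = do {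
     c \<leftarrow> Pi_pmf {1..d} undefined (\<lambda>i. pmf_of_set (urn d n x i));
     \<sigma> \<leftarrow> \<mu>;
     return_pmf (\<lambda>b. if b \<in> c ` {1..d} then \<sigma> (x b) else x b)
   }"

definition labeled_stationary :: "nat \<Rightarrow> nat \<Rightarrow> (nat \<Rightarrow> nat) pmf" where
  "labeled_stationary d n = pmf_of_set (labeled_states d n)"

definition d_lab :: "nat \<Rightarrow> nat \<Rightarrow> (nat \<Rightarrow> nat) pmf \<Rightarrow> real \<Rightarrow> real" where
  "d_lab d n \<mu> =
     worst_case_tv (labeled_states d n) (labeled_step d n \<mu>) (labeled_stationary d n)"


section \<open>The balanced chain\<close>

text \<open>A state maps each urn to the multiset of the colours in \<open>{1..d}\<close> of its balls, so that
  \<open>count (y i) a\<close> is the number of balls of colour \<open>a\<close> in urn \<open>i\<close>.\<close>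

definition balanced_states :: "nat \<Rightarrow> nat \<Rightarrow> (nat \<Rightarrow> nat multiset) set" where
  "balanced_states d n =
     {y. (\<forall>i\<in>{1..d}. size (y i) = n \<and> set_mset (y i) \<subseteq> {1..d}) \<and>
         (\<forall>a\<in>{1..d}. (\<Sum>i\<in>{1..d}. count (y i) a) = n) \<and>
         (\<forall>i. i \<notin> {1..d} \<longrightarrow> y i = {#})}"

text \<open>Here \<open>c i\<close> is the colour of the ball chosen from urn \<open>i\<close>. It has colour \<open>a\<close> with
  probability \<open>count (y i) a / n\<close>, as each of the \<open>n\<close> balls is equally likely.\<close>

definition balanced_step ::
    "nat \<Rightarrow> (nat \<Rightarrow> nat) pmf \<Rightarrow> (nat \<Rightarrow> nat multiset) \<Rightarrow> (nat \<Rightarrow> nat multiset) pmf" where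
  "balanced_step d \<mu> y = do {
     c \<leftarrow> Pi_pmf {1..d} undefined (\<lambda>i. pmf_of_multiset (y i));
     \<sigma> \<leftarrow> \<mu>;
     return_pmf (\<lambda>j. if j \<in> {1..d}
                       then y j - {#c j#} + (\<Sum>i | i \<in> {1..d} \<and> \<sigma> i = j. {#c i#})
                       else {#})
   }"

definition colour_state ::
    "nat \<Rightarrow> nat \<Rightarrow> (nat \<Rightarrow> nat) \<Rightarrow> (nat \<Rightarrow> nat) \<Rightarrow> (nat \<Rightarrow> nat multiset)" where
  "colour_state d n \<kappa> x = (\<lambda>i. image_mset \<kappa> (mset_set (urn d n x i)))"

definition block_colouring :: "nat \<Rightarrow> nat \<Rightarrow> nat" where
  "block_colouring n b = (b - 1) div n + 1"

text \<open>Labels \<open>1, \<dots>, n\<close> get colour 1, labels \<open>n + 1, \<dots>, 2n\<close> get colour 2, and so on. Any other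
  colouring with \<open>n\<close> labels per colour gives the same distribution, as shown below.\<close>

definition balanced_stationary :: "nat \<Rightarrow> nat \<Rightarrow> (nat \<Rightarrow> nat multiset) pmf" where
  "balanced_stationary d n =
     map_pmf (colour_state d n (block_colouring n)) (labeled_stationary d n)"

definition d_bal :: "nat \<Rightarrow> nat \<Rightarrow> (nat \<Rightarrow> nat) pmf \<Rightarrow> real \<Rightarrow> real" where
  "d_bal d n \<mu> =
     worst_case_tv (balanced_states d n) (balanced_step d \<mu>) (balanced_stationary d n)"


section \<open>Well-definedness\<close>

definition is_colouring :: "nat \<Rightarrow> nat \<Rightarrow> (nat \<Rightarrow> nat) \<Rightarrow> bool" where
  "is_colouring d n \<kappa> \<longleftrightarrow>
     \<kappa> \<in> {1..d * n} \<rightarrow> {1..d} \<and> (\<forall>a\<in>{1..d}. card {b \<in> {1..d * n}. \<kappa> b = a} = n)"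

lemma block_colouring_eq_iff:
  assumes "n \<ge> 1" "b \<ge> 1"
  shows "block_colouring n b = Suc a \<longleftrightarrow> b \<in> {a * n + 1..a * n + n}"
proof -
  have "(b - 1) div n = a \<longleftrightarrow> a * n \<le> b - 1 \<and> b - 1 < a * n + n"
    using assms by (metis div_nat_eqI dividend_less_div_times div_times_less_eq_dividend
        less_le_trans mult.commute add.commute mult_Suc not_one_le_zero not_gr_zero)
  also have "\<dots> \<longleftrightarrow> b \<in> {a * n + 1..a * n + n}"
    using assms by (simp add: le_diff_conv2) linarith
  finally show ?thesis by (simp add: block_colouring_def)
qed

lemma is_colouring_block:
  assumes "n \<ge> 1"
  shows "is_colouring d n (block_colouring n)"
proof -
  have "(b - 1) div n < d" if "b \<in> {1..d * n}" for b
    using that assms by (intro div_less_iff_less_mult[THEN iffD2]) auto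
  then have 1: "block_colouring n \<in> {1..d * n} \<rightarrow> {1..d}"
    by (auto simp: block_colouring_def Suc_le_eq)
  have "card {b \<in> {1..d * n}. block_colouring n b = a} = n" if a: "a \<in> {1..d}" for a
  proof -
    obtain a' where a': "a = Suc a'" using a by (cases a) auto
    have "Suc a' * n \<le> d * n" using a a' by (intro mult_right_mono) auto
    then have "{b \<in> {1..d * n}. block_colouring n b = a} = {a' * n + 1..a' * n + n}"
      using assms block_colouring_eq_iff[of n _ a'] unfolding a' by auto
    then show ?thesis by simp
  qed
  with 1 show ?thesis by (simp add: is_colouring_def)
qed

lemma finite_labeled_states: "finite (labeled_states d n)"
proof (rule finite_subset)
  show "labeled_states d n \<subseteq> {1..d * n} \<rightarrow>\<^sub>E {1..d}"
    unfolding labeled_states_def by (rule Collect_restrict)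
qed (intro finite_PiE finite_atLeastAtMost)

lemma labeled_states_nonempty:
  assumes "n \<ge> 1"
  shows "labeled_states d n \<noteq> {}"
proof -
  have "urn d n (restrict (block_colouring n) {1..d * n}) i
          = {b \<in> {1..d * n}. block_colouring n b = i}" for i
    by (auto simp: urn_def)
  then have "restrict (block_colouring n) {1..d * n} \<in> labeled_states d n"
    using is_colouring_block[OF assms, of d]
    by (simp add: labeled_states_def is_colouring_def)
  then show ?thesis by blast
qed

lemma finite_balanced_states: "finite (balanced_states d n)"
proof -
  have "{m. set_mset m \<subseteq> {1..d} \<and> size m = n}
          \<subseteq> mset ` {xs. set xs \<subseteq> {1..d} \<and> length xs = n}"
  proof
    fix m assume "m \<in> {m. set_mset m \<subseteq> {1..d} \<and> size m = n}"
    moreover obtain xs where "m = mset xs" by (metis ex_mset)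
    ultimately show "m \<in> mset ` {xs. set xs \<subseteq> {1..d} \<and> length xs = n}" by auto
  qed
  then have "finite {m. set_mset m \<subseteq> {1..d} \<and> size m = n}"
    by (rule finite_subset) (intro finite_imageI finite_lists_length_eq finite_atLeastAtMost)
  from finite_set_of_finite_funs[OF finite_atLeastAtMost[of 1 d] this, of "{#}"]
  show ?thesis by (rule finite_subset[rotated]) (auto simp: balanced_states_def)
qed

lemma colour_state_balanced:
  assumes x: "x \<in> labeled_states d n" and \<kappa>: "is_colouring d n \<kappa>"
  shows "colour_state d n \<kappa> x \<in> balanced_states d n"
proof -
  have xd: "x b \<in> {1..d}" if "b \<in> {1..d * n}" for b
    using x that unfolding labeled_states_def by blast
  have "(\<Sum>i\<in>{1..d}. count (colour_state d n \<kappa> x i) a) = n" if a: "a \<in> {1..d}" for a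
  proof -
    have "(\<Sum>i\<in>{1..d}. count (colour_state d n \<kappa> x i) a)
            = (\<Sum>i\<in>{1..d}. card {b \<in> {1..d * n}. x b = i \<and> \<kappa> b = a})"
      by (intro sum.cong refl)
        (auto simp: colour_state_def count_image_mset urn_def intro!: arg_cong[of _ _ card])
    also have "\<dots> = card (\<Union>i\<in>{1..d}. {b \<in> {1..d * n}. x b = i \<and> \<kappa> b = a})"
      by (rule card_UN_disjoint[symmetric]) auto
    also have "(\<Union>i\<in>{1..d}. {b \<in> {1..d * n}. x b = i \<and> \<kappa> b = a})
                 = {b \<in> {1..d * n}. \<kappa> b = a}"
      using xd by auto
    finally show ?thesis using \<kappa> a by (simp add: is_colouring_def)
  qed
  moreover have "urn d n x i = {}" if "i \<notin> {1..d}" for i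
    using xd that by (auto simp: urn_def)
  moreover have "size (colour_state d n \<kappa> x i) = n" if "i \<in> {1..d}" for i
    using x that by (simp add: colour_state_def labeled_states_def)
  moreover have "set_mset (colour_state d n \<kappa> x i) \<subseteq> {1..d}" for i
    using \<kappa> unfolding is_colouring_def by (auto simp: colour_state_def urn_def)
  ultimately show ?thesis by (simp add: balanced_states_def colour_state_def)
qed

lemma balanced_states_nonempty: "n \<ge> 1 \<Longrightarrow> balanced_states d n \<noteq> {}"
  using colour_state_balanced is_colouring_block labeled_states_nonempty by blast

lemma colouring_image_mset_eq:
  assumes "is_colouring d n \<kappa>" "is_colouring d n \<kappa>'"
  shows "image_mset \<kappa> (mset_set {1..d * n}) = image_mset \<kappa>' (mset_set {1..d * n})"
proof (rule multiset_eqI)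
  have count: "count (image_mset f (mset_set {1..d * n})) a = (if a \<in> {1..d} then n else 0)"
    if f: "is_colouring d n f" for f :: "nat \<Rightarrow> nat" and a
  proof -
    have "count (image_mset f (mset_set {1..d * n})) a = card {b \<in> {1..d * n}. f b = a}"
      by (simp add: count_image_mset vimage_def Int_def conj_commute)
    moreover have "{b \<in> {1..d * n}. f b = a} = {}" if "a \<notin> {1..d}"
      using f that by (auto simp: is_colouring_def)
    ultimately show ?thesis using f by (auto simp: is_colouring_def)
  qed
  show "count (image_mset \<kappa> (mset_set {1..d * n})) a
          = count (image_mset \<kappa>' (mset_set {1..d * n})) a" for a
    unfolding count[OF assms(1)] count[OF assms(2)] ..
qed

theorem balanced_stationary_eq:
  assumes n: "n \<ge> 1" and \<kappa>: "is_colouring d n \<kappa>"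
  shows "map_pmf (colour_state d n \<kappa>) (labeled_stationary d n) = balanced_stationary d n"
proof -
  define B where "B = {1..d * n}"
  obtain p where p: "p permutes B" "\<forall>b\<in>B. \<kappa> b = block_colouring n (p b)"
    using image_mset_eq_implies_permutes[of B \<kappa> "block_colouring n"]
      colouring_image_mset_eq[OF \<kappa> is_colouring_block[OF n]] by (auto simp: B_def)
  have mem: "p b \<in> B \<longleftrightarrow> b \<in> B" "inv p b \<in> B \<longleftrightarrow> b \<in> B" for b
    using permutes_in_image[OF p(1)] permutes_in_image[OF permutes_inv[OF p(1)]] by auto
  have urn: "urn d n x i = p ` urn d n (x \<circ> p) i" for x i
  proof -
    have "b \<in> p ` urn d n (x \<circ> p) i" if "b \<in> urn d n x i" for b
      using that mem[of b] unfolding urn_def B_def[symmetric]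
      by (intro image_eqI[of _ _ "inv p b"]) (simp_all add: permutes_inverses[OF p(1)])
    moreover have "p b \<in> urn d n x i" if "b \<in> urn d n (x \<circ> p) i" for b
      using that mem[of b] unfolding urn_def B_def[symmetric] by simp
    ultimately show ?thesis by blast
  qed
  have inj: "inj_on p A" for A
    using permutes_inj[OF p(1)] by (rule inj_on_subset) simp
  have colour: "colour_state d n \<kappa> (x \<circ> p) = colour_state d n (block_colouring n) x" for x
  proof
    fix i
    have "colour_state d n (block_colouring n) x i
            = image_mset (block_colouring n) (image_mset p (mset_set (urn d n (x \<circ> p) i)))"
      by (simp add: colour_state_def urn[of x] image_mset_mset_set inj)
    also have "\<dots> = image_mset \<kappa> (mset_set (urn d n (x \<circ> p) i))"
      using p(2) by (auto simp: multiset.map_comp urn_def B_def intro!: image_mset_cong)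
    finally show "colour_state d n \<kappa> (x \<circ> p) i = colour_state d n (block_colouring n) x i"
      by (simp add: colour_state_def)
  qed
  have states: "x \<circ> q \<in> labeled_states d n"
    if "x \<in> labeled_states d n" "q permutes B" "\<And>x i. card (urn d n (x \<circ> q) i) = card (urn d n x i)"
    for x q
    using that permutes_in_image[OF that(2)] permutes_not_in[OF that(2)]
    unfolding labeled_states_def B_def PiE_def extensional_def Pi_def
    by auto
  have card: "card (urn d n (x \<circ> p) i) = card (urn d n x i)" for x i
    by (subst (2) urn) (simp add: card_image inj)
  have card': "card (urn d n (x \<circ> inv p) i) = card (urn d n x i)" for x i
    using card[of "x \<circ> inv p" i] permutes_inv_o[OF p(1)] by (simp add: comp_assoc)
  have "bij_betw (\<lambda>x. x \<circ> p) (labeled_states d n) (labeled_states d n)"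
    by (rule bij_betwI[where g = "\<lambda>x. x \<circ> inv p"])
      (use states p(1) permutes_inv[OF p(1)] card card' permutes_inv_o[OF p(1)]
        in \<open>auto simp: comp_assoc\<close>)
  then have "map_pmf (\<lambda>x. x \<circ> p) (labeled_stationary d n) = labeled_stationary d n"
    unfolding labeled_stationary_def
    by (intro map_pmf_of_set_bij_betw labeled_states_nonempty finite_labeled_states n)
  then have "map_pmf (colour_state d n \<kappa>) (labeled_stationary d n)
      = map_pmf (colour_state d n \<kappa>) (map_pmf (\<lambda>x. x \<circ> p) (labeled_stationary d n))"
    by simp
  also have "\<dots> = balanced_stationary d n"
    by (simp add: pmf.map_comp o_def[of "colour_state d n \<kappa>"] colour balanced_stationary_def)
  finally show ?thesis .
qed

end

theory Submission
  imports Defs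
begin

text \<open>
  The balanced chain is the image of the labeled chain under any colouring, so its distance from
  stationarity is at most that of the labeled chain. Conversely, fix a labeled initial state \<open>x\<close>
  and colour every ball by the urn in which it starts. Two states with the same colour
  configuration differ by a relabeling of the balls that fixes \<open>x\<close>, and the dynamics commutes
  with relabelings. Hence the law at time \<open>t\<close> and the uniform distribution are both constant on
  the fibres of the colouring map, and projecting them to the balanced chain loses no total
  variation distance.
\<close>

section \<open>Total variation distance and projections\<close>

lemma bdd_above_tv_dist:
  "bdd_above (range (\<lambda>A. \<bar>measure_pmf.prob p A - measure_pmf.prob q A\<bar>))"
proof (rule bdd_aboveI2)
  fix A
  have "0 \<le> measure_pmf.prob p A" "measure_pmf.prob p A \<le> 1"
       "0 \<le> measure_pmf.prob q A" "measure_pmf.prob q A \<le> 1" by simp_all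
  then show "\<bar>measure_pmf.prob p A - measure_pmf.prob q A\<bar> \<le> 1" by linarith
qed

lemma prob_diff_le_tv_dist: "\<bar>measure_pmf.prob p A - measure_pmf.prob q A\<bar> \<le> tv_dist p q"
  unfolding tv_dist_def by (rule cSUP_upper[OF UNIV_I bdd_above_tv_dist])

lemma tv_dist_leI:
  assumes "\<And>A. \<bar>measure_pmf.prob p A - measure_pmf.prob q A\<bar> \<le> c"
  shows "tv_dist p q \<le> c"
  unfolding tv_dist_def by (rule cSUP_least) (use assms in auto)

lemma tv_dist_map_le: "tv_dist (map_pmf f p) (map_pmf f q) \<le> tv_dist p q"
  by (rule tv_dist_leI) (simp add: prob_diff_le_tv_dist)

text \<open>Equality case of \<open>tv_dist_map_le\<close>: \<open>f\<close> is a sufficient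
  statistic for the pair, so an optimal separating event can already be seen through
  \<open>f\<close>.\<close>

lemma tv_dist_map_sufficient:
  assumes S: "finite S" "set_pmf p \<subseteq> S" "set_pmf q \<subseteq> S"
    and p: "\<And>z z'. z \<in> S \<Longrightarrow> z' \<in> S \<Longrightarrow> f z = f z' \<Longrightarrow> pmf p z = pmf p z'"
    and q: "\<And>z z'. z \<in> S \<Longrightarrow> z' \<in> S \<Longrightarrow> f z = f z' \<Longrightarrow> pmf q z = pmf q z'"
  shows "tv_dist (map_pmf f p) (map_pmf f q) = tv_dist p q"
proof (rule antisym[OF tv_dist_map_le tv_dist_leI])
  fix A
  \<comment> \<open>The maximiser of \<open>p A - q A\<close> is a union of fibres of \<open>f\<close>.\<close>
  define P where "P = {z \<in> S. pmf p z > pmf q z}"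
  have fP: "z \<in> P" if z: "z \<in> S" and "f z \<in> f ` P" for z
  proof -
    from that(2) obtain z' where z': "z' \<in> S" "pmf p z' > pmf q z'" "f z = f z'"
      by (auto simp: P_def)
    then show ?thesis using p[OF z z'(1,3)] q[OF z z'(1,3)] z by (simp add: P_def)
  qed
  have prob: "measure_pmf.prob r B = (\<Sum>z\<in>B \<inter> S. pmf r z)" if "set_pmf r \<subseteq> S" for r B
  proof -
    have "measure_pmf.prob r B = measure_pmf.prob r (B \<inter> S)"
      using that by (intro measure_pmf.finite_measure_eq_AE) (auto simp: AE_measure_pmf_iff)
    then show ?thesis using S(1) by (simp add: measure_measure_pmf_finite)
  qed
  have diff: "measure_pmf.prob p B - measure_pmf.prob q B = (\<Sum>z\<in>B \<inter> S. pmf p z - pmf q z)" for B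
    using S by (simp add: prob sum_subtractf)
  \<comment> \<open>Replacing \<open>B \<inter> S\<close> by \<open>B \<inter> P\<close> drops
    nonpositive terms; enlarging to \<open>P\<close> adds positive ones.\<close>
  have le: "measure_pmf.prob p B - measure_pmf.prob q B \<le> (\<Sum>z\<in>P. pmf p z - pmf q z)" for B
  proof -
    have "(\<Sum>z\<in>B \<inter> S. pmf p z - pmf q z) \<le> (\<Sum>z\<in>B \<inter> P. pmf p z - pmf q z)"
    proof -
      have "(\<Sum>z\<in>B \<inter> S. pmf p z - pmf q z)
          \<le> (\<Sum>z\<in>B \<inter> S. if z \<in> P then pmf p z - pmf q z else 0)"
        by (rule sum_mono) (auto simp: P_def)
      also have "\<dots> = (\<Sum>z\<in>B \<inter> P. pmf p z - pmf q z)"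
        using S(1) by (simp add: sum.inter_restrict[symmetric] Int_assoc) (simp add: P_def Int_def)
      finally show ?thesis .
    qed
    also have "\<dots> \<le> (\<Sum>z\<in>P. pmf p z - pmf q z)"
      using S(1) by (intro sum_mono2) (auto simp: P_def)
    finally show ?thesis by (simp add: diff)
  qed
  have "f -` f ` P \<inter> S = P" using fP by (auto simp: P_def)
  then have "(\<Sum>z\<in>P. pmf p z - pmf q z)
      = measure_pmf.prob (map_pmf f p) (f ` P) - measure_pmf.prob (map_pmf f q) (f ` P)"
    by (simp add: diff)
  also have "\<dots> \<le> tv_dist (map_pmf f p) (map_pmf f q)"
    using prob_diff_le_tv_dist[of "map_pmf f p" "f ` P" "map_pmf f q"] by linarith
  finally have "measure_pmf.prob p B - measure_pmf.prob q B
      \<le> tv_dist (map_pmf f p) (map_pmf f q)" for B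
    using le[of B] by linarith
  \<comment> \<open>Complementing the event negates the difference, so the one-sided bound yields
    both signs of the absolute value.\<close>
  from this[of A] this[of "- A"]
  show "\<bar>measure_pmf.prob p A - measure_pmf.prob q A\<bar> \<le> tv_dist (map_pmf f p) (map_pmf f q)"
    using measure_pmf.prob_compl[of A p] measure_pmf.prob_compl[of A q]
    by (simp add: Compl_eq_Diff_UNIV abs_le_iff)
qed


section \<open>Intertwined chains\<close>

lemma set_chain_steps:
  assumes "\<And>x. x \<in> S \<Longrightarrow> set_pmf (K x) \<subseteq> S" "x \<in> S"
  shows "set_pmf (chain_steps K k x) \<subseteq> S"
  using assms by (induction k) (simp, force)

lemma set_chain_law:
  assumes "\<And>x. x \<in> S \<Longrightarrow> set_pmf (K x) \<subseteq> S" "x \<in> S"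
  shows "set_pmf (chain_law K t x) \<subseteq> S"
  using set_chain_steps[OF assms] by (fastforce simp: chain_law_def)

text \<open>The number of jumps is independent of the state, so commuting with one step suffices. It
  serves both for projecting to colours and for relabeling balls; closure of \<open>S\<close> keeps
  the chain where the one-step identity holds.\<close>

lemma map_chain_law:
  assumes S: "\<And>x. x \<in> S \<Longrightarrow> set_pmf (K x) \<subseteq> S" "x \<in> S"
    and f: "\<And>x. x \<in> S \<Longrightarrow> map_pmf f (K x) = L (f x)"
  shows "map_pmf f (chain_law K t x) = chain_law L t (f x)"
proof -
  have "map_pmf f (chain_steps K k x) = chain_steps L k (f x)" for k
  proof (induction k)
    case (Suc k)
    have "map_pmf f (chain_steps K (Suc k) x) = chain_steps K k x \<bind> (\<lambda>z. L (f z))"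
      unfolding chain_steps.simps map_bind_pmf
      by (rule bind_pmf_cong[OF refl]) 
        (use set_chain_steps[of S K x k] S in \<open>auto intro!: f\<close>)
    also have "\<dots> = map_pmf f (chain_steps K k x) \<bind> L"
      by (simp add: bind_map_pmf)
    finally show ?case by (simp add: Suc.IH)
  qed simp
  then show ?thesis by (simp add: chain_law_def map_bind_pmf)
qed

text \<open>Since \<open>f\<close> may change the default value, the image function has to be reset
  outside \<open>A\<close>; plain composition with \<open>f\<close> would not do.\<close>

lemma Pi_pmf_map_default:
  assumes "finite A"
  shows "Pi_pmf A dflt' (\<lambda>i. map_pmf f (p i))
    = map_pmf (\<lambda>h i. if i \<in> A then f (h i) else dflt') (Pi_pmf A dflt p)"
  unfolding map_pmf_def using assms
  by (simp add: Pi_pmf_bind[where d' = dflt])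


section \<open>The labeled chain and its projections\<close>

text \<open>Outcome of a labeled step once its randomness is fixed, so that the counting in urns is
  separated from the probability.\<close>

definition move_balls ::
    "nat \<Rightarrow> (nat \<Rightarrow> nat) \<Rightarrow> (nat \<Rightarrow> nat) \<Rightarrow> (nat \<Rightarrow> nat) \<Rightarrow> (nat \<Rightarrow> nat)" where
  "move_balls d x c \<sigma> = (\<lambda>b. if b \<in> c ` {1..d} then \<sigma> (x b) else x b)"

lemma labeled_states_in_urn: "x \<in> labeled_states d n \<Longrightarrow> b \<in> {1..d * n} \<Longrightarrow> x b \<in> {1..d}"
  unfolding labeled_states_def by blast

lemma finite_urn [simp]: "finite (urn d n x i)"
  by (simp add: urn_def)

lemma urn_outside: "x \<in> labeled_states d n \<Longrightarrow> i \<notin> {1..d} \<Longrightarrow> urn d n x i = {}"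
  using labeled_states_in_urn[of x d n] by (auto simp: urn_def)

lemma card_urn: "x \<in> labeled_states d n \<Longrightarrow> i \<in> {1..d} \<Longrightarrow> card (urn d n x i) = n"
  by (simp add: labeled_states_def)

lemma urn_nonempty:
  assumes "n \<ge> 1" "x \<in> labeled_states d n" "i \<in> {1..d}"
  shows "urn d n x i \<noteq> {}"
  using card_urn[OF assms(2,3)] assms(1) by auto

lemma set_Pi_pmf_urn:
  assumes "n \<ge> 1" "x \<in> labeled_states d n"
    and "c \<in> set_pmf (Pi_pmf {1..d} dflt (\<lambda>i. pmf_of_set (urn d n x i)))" "i \<in> {1..d}"
  shows "c i \<in> urn d n x i"
proof -
  have "c i \<in> set_pmf (pmf_of_set (urn d n x i))"
    using assms(3,4) by (simp add: set_Pi_pmf PiE_dflt_def)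
  then show ?thesis using urn_nonempty[OF assms(1,2,4)] by simp
qed

lemma labeled_step_eq:
  "labeled_step d n \<mu> x = Pi_pmf {1..d} undefined (\<lambda>i. pmf_of_set (urn d n x i)) \<bind>
     (\<lambda>c. map_pmf (move_balls d x c) \<mu>)"
  by (simp add: labeled_step_def move_balls_def map_pmf_def)

context
  fixes d n :: nat and x c \<sigma> :: "nat \<Rightarrow> nat"
  assumes x: "x \<in> labeled_states d n"
    and c: "\<And>i. i \<in> {1..d} \<Longrightarrow> c i \<in> urn d n x i"
    and \<sigma>: "\<sigma> permutes {1..d}"
begin

lemma move_balls_in_urn: "b \<in> {1..d * n} \<Longrightarrow> move_balls d x c \<sigma> b \<in> {1..d}"
  using labeled_states_in_urn[OF x] permutes_in_image[OF \<sigma>] by (simp add: move_balls_def)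

lemma chosen_from: "i \<in> {1..d} \<Longrightarrow> x (c i) = i"
  using c by (simp add: urn_def)

text \<open>As \<sigma> is a bijection, exactly one ball leaves urn \<open>j\<close> and exactly one
  arrives, from urn \<open>inv \<sigma> j\<close>. The second claim makes the arrival count as a new
  element, also when \<open>\<sigma> j = j\<close> and the ball returns.\<close>

lemma urn_move_balls:
  assumes j: "j \<in> {1..d}"
  shows "urn d n (move_balls d x c \<sigma>) j = insert (c (inv \<sigma> j)) (urn d n x j - {c j})"
    and "c (inv \<sigma> j) \<notin> urn d n x j - {c j}"
proof -
  have i: "inv \<sigma> j \<in> {1..d}"
    using permutes_in_image[OF permutes_inv[OF \<sigma>]] j by simp
  have \<sigma>j: "\<sigma> i = j \<longleftrightarrow> i = inv \<sigma> j" for i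
    using permutes_inv_eq[OF \<sigma>] by metis
  have mem: "c i \<in> {1..d * n}" if "i \<in> {1..d}" for i
    using c[OF that] by (simp add: urn_def)
  show "c (inv \<sigma> j) \<notin> urn d n x j - {c j}"
    using chosen_from[OF i] by (auto simp: urn_def)
  show "urn d n (move_balls d x c \<sigma>) j = insert (c (inv \<sigma> j)) (urn d n x j - {c j})"
  proof (intro equalityI subsetI)
    fix b assume b: "b \<in> urn d n (move_balls d x c \<sigma>) j"
    show "b \<in> insert (c (inv \<sigma> j)) (urn d n x j - {c j})"
    proof (cases "b \<in> c ` {1..d}")
      case True
      then obtain i where "i \<in> {1..d}" "b = c i" by blast
      with b True chosen_from[of i] \<sigma>j[of i] show ?thesis
        by (simp add: urn_def move_balls_def)
    next
      case False
      with b j show ?thesis by (auto simp: urn_def move_balls_def)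
    qed
  next
    fix b assume b: "b \<in> insert (c (inv \<sigma> j)) (urn d n x j - {c j})"
    show "b \<in> urn d n (move_balls d x c \<sigma>) j"
    proof (cases "b = c (inv \<sigma> j)")
      case True
      with i mem[OF i] chosen_from[OF i] \<sigma>j show ?thesis
        by (simp add: urn_def move_balls_def)
    next
      case False
      with b have "b \<in> urn d n x j" "b \<noteq> c j" by auto
      \<comment> \<open>Each chosen ball sits in the urn it was chosen from, so \<open>c j\<close>
        is the only chosen ball in urn \<open>j\<close>.\<close>
      moreover from this have "b \<notin> c ` {1..d}"
        using chosen_from by (auto simp: urn_def)
      ultimately show ?thesis by (simp add: urn_def move_balls_def)
    qed
  qed
qed

lemma move_balls_labeled_states: "move_balls d x c \<sigma> \<in> labeled_states d n"
proof -
  have "card (urn d n (move_balls d x c \<sigma>) j) = n" if j: "j \<in> {1..d}" for j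
    using urn_move_balls[OF j] c[OF j] card_urn[OF x j]
      card_Suc_Diff1[of "urn d n x j" "c j"] by (simp del: card_Diff_insert)
  moreover have "move_balls d x c \<sigma> b = undefined" if "b \<notin> {1..d * n}" for b
  proof -
    have "b \<notin> c ` {1..d}" using c that by (auto simp: urn_def)
    with x that show ?thesis by (auto simp: move_balls_def labeled_states_def PiE_def extensional_def)
  qed
  ultimately show ?thesis
    using move_balls_in_urn by (auto simp: labeled_states_def PiE_def extensional_def)
qed

lemma colour_state_move_balls:
  "colour_state d n \<kappa> (move_balls d x c \<sigma>) j
    = (if j \<in> {1..d}
       then colour_state d n \<kappa> x j - {#\<kappa> (c j)#} + (\<Sum>i | i \<in> {1..d} \<and> \<sigma> i = j. {#\<kappa> (c i)#})
       else {#})"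
proof (cases "j \<in> {1..d}")
  case True
  have "inv \<sigma> j \<in> {1..d}"
    using permutes_in_image[OF permutes_inv[OF \<sigma>]] True by simp
  \<comment> \<open>The sum over arriving colours thus has a single term, matching the single
    inserted ball.\<close>
  then have "{i. i \<in> {1..d} \<and> \<sigma> i = j} = {inv \<sigma> j}"
    using permutes_inverses[OF \<sigma>] by auto
  then show ?thesis
    using True urn_move_balls[OF True] c[OF True]
    by (simp add: colour_state_def mset_set_Diff image_mset_Diff)
next
  case False
  then show ?thesis
    unfolding if_not_P[OF False] colour_state_def
    by (simp only: urn_outside[OF move_balls_labeled_states False]) simp
qed

end

lemma set_labeled_step:
  assumes "n \<ge> 1" "set_pmf \<mu> \<subseteq> {\<sigma>. \<sigma> permutes {1..d}}" "x \<in> labeled_states d n"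
  shows "set_pmf (labeled_step d n \<mu> x) \<subseteq> labeled_states d n"
  using assms set_Pi_pmf_urn[OF assms(1,3)]
  by (auto simp: labeled_step_eq intro!: move_balls_labeled_states)

text \<open>The colour of a uniform ball of an urn is a uniform draw from the urn's colour multiset,
  and the update of the colour contents depends on the chosen balls only through their
  colours.\<close>

lemma map_labeled_step_colour_state:
  assumes n: "n \<ge> 1" and \<mu>: "set_pmf \<mu> \<subseteq> {\<sigma>. \<sigma> permutes {1..d}}"
    and x: "x \<in> labeled_states d n"
  shows "map_pmf (colour_state d n \<kappa>) (labeled_step d n \<mu> x)
    = balanced_step d \<mu> (colour_state d n \<kappa> x)"
proof -
  let ?P = "Pi_pmf {1..d} undefined (\<lambda>i. pmf_of_set (urn d n x i))"
  let ?C = "\<lambda>c i. if i \<in> {1..d} then \<kappa> (c i) else undefined"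
  have P: "Pi_pmf {1..d} undefined (\<lambda>i. pmf_of_multiset (colour_state d n \<kappa> x i)) = map_pmf ?C ?P"
    unfolding Pi_pmf_map_default[OF finite_atLeastAtMost, symmetric]
    by (rule Pi_pmf_cong) (simp_all add: colour_state_def map_pmf_of_set urn_nonempty[OF n x])
  have eq: "colour_state d n \<kappa> (move_balls d x c \<sigma>) = (\<lambda>j. if j \<in> {1..d}
        then colour_state d n \<kappa> x j - {#?C c j#} + (\<Sum>i | i \<in> {1..d} \<and> \<sigma> i = j. {#?C c i#})
        else {#})"
    if "c \<in> set_pmf ?P" "\<sigma> \<in> set_pmf \<mu>" for c \<sigma>
    using that \<mu> set_Pi_pmf_urn[OF n x that(1)]
    by (intro ext, subst colour_state_move_balls[OF x]) auto
  show ?thesis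
    unfolding labeled_step_eq balanced_step_def P bind_map_pmf map_bind_pmf pmf.map_comp
    by (intro bind_pmf_cong refl)
      (auto simp: map_pmf_def[of "_ \<circ> _"] eq simp del: atLeastAtMost_iff intro!: bind_pmf_cong)
qed


section \<open>Relabeling the balls\<close>

context
  fixes d n :: nat and p :: "nat \<Rightarrow> nat"
  assumes p: "p permutes {1..d * n}"
begin

lemma urn_comp_permutes: "urn d n (x \<circ> p) i = inv p ` urn d n x i"
proof -
  have "urn d n (x \<circ> p) i = p -` urn d n x i"
    using permutes_in_image[OF p] by (auto simp: urn_def)
  then show ?thesis
    by (simp add: bij_vimage_eq_inv_image[OF permutes_bij[OF p]])
qed

lemma comp_permutes_labeled_states:
  assumes "x \<in> labeled_states d n"
  shows "x \<circ> p \<in> labeled_states d n"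
proof -
  have "inj_on (inv p) A" for A
    using permutes_inj[OF permutes_inv[OF p]] by (rule inj_on_subset) simp
  then have "card (urn d n (x \<circ> p) i) = card (urn d n x i)" for i
    by (simp add: urn_comp_permutes card_image)
  with assms show ?thesis
    using permutes_in_image[OF p] permutes_not_in[OF p]
    by (auto simp: labeled_states_def PiE_def extensional_def Pi_def)
qed

text \<open>The step never looks at labels: \<open>inv p\<close> carries the uniform choice from an
  urn of \<open>x\<close> to the uniform choice from the same urn of \<open>x \<circ> p\<close>, and
  \<sigma> acts on urns only.\<close>

lemma map_labeled_step_comp_permutes:
  assumes n: "n \<ge> 1" and x: "x \<in> labeled_states d n"
  shows "map_pmf (\<lambda>x. x \<circ> p) (labeled_step d n \<mu> x) = labeled_step d n \<mu> (x \<circ> p)"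
proof -
  let ?C = "\<lambda>c i. if i \<in> {1..d} then inv p (c i) else undefined"
  have inj: "inj_on (inv p) A" for A
    using permutes_inj[OF permutes_inv[OF p]] by (rule inj_on_subset) simp
  have P: "Pi_pmf {1..d} undefined (\<lambda>i. pmf_of_set (urn d n (x \<circ> p) i))
      = map_pmf ?C (Pi_pmf {1..d} undefined (\<lambda>i. pmf_of_set (urn d n x i)))"
    unfolding Pi_pmf_map_default[OF finite_atLeastAtMost, symmetric]
    by (rule Pi_pmf_cong)
      (simp_all add: urn_comp_permutes map_pmf_of_set_inj urn_nonempty[OF n x] inj)
  have "b \<in> ?C c ` {1..d} \<longleftrightarrow> p b \<in> c ` {1..d}" for b c
    using permutes_inv_eq[OF p] by (auto simp: image_iff eq_commute[of b])
  then have "move_balls d x c \<sigma> \<circ> p = move_balls d (x \<circ> p) (?C c) \<sigma>" for c \<sigma>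
    by (simp add: move_balls_def fun_eq_iff)
  then have move: "(\<lambda>x. x \<circ> p) \<circ> move_balls d x c = move_balls d (x \<circ> p) (?C c)" for c
    by (simp add: fun_eq_iff)
  show ?thesis
    unfolding labeled_step_eq P bind_map_pmf map_bind_pmf pmf.map_comp move ..
qed

end

text \<open>Here \<open>x\<close> is also the colouring. The colour state of \<open>z\<close> counts
  how often each pair (urn, colour) occurs, so \<open>z\<close> and \<open>z'\<close> have the same
  multiset of pairs; a permutation matching these pairs respects both coordinates.\<close>

lemma colour_state_eq_imp_relabeling:
  assumes x: "x \<in> labeled_states d n" and z: "z \<in> labeled_states d n" "z' \<in> labeled_states d n"
    and eq: "colour_state d n x z = colour_state d n x z'"
  obtains p where "p permutes {1..d * n}" "x \<circ> p = x" "z' \<circ> p = z"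
proof -
  let ?B = "{1..d * n}"
  have count: "count (image_mset (\<lambda>b. (w b, x b)) (mset_set ?B)) (j, a)
      = count (colour_state d n x w j) a" for w :: "nat \<Rightarrow> nat" and j a
    by (auto simp: colour_state_def count_image_mset urn_def intro!: arg_cong[of _ _ card])
  have "image_mset (\<lambda>b. (z b, x b)) (mset_set ?B) = image_mset (\<lambda>b. (z' b, x b)) (mset_set ?B)"
    by (rule multiset_eqI) (simp only: split_paired_all count eq)
  then obtain p where p: "p permutes ?B" "\<forall>b\<in>?B. (z b, x b) = (z' (p b), x (p b))"
    by (rule image_mset_eq_implies_permutes[OF finite_atLeastAtMost])
  \<comment> \<open>The matching is known on labels of balls only; elsewhere \<open>p\<close> is the
    identity and all states equal \<open>undefined\<close>.\<close>
  have "w (p b) = w' b" if "w \<in> labeled_states d n" "w' \<in> labeled_states d n"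
      "\<forall>b\<in>?B. w (p b) = w' b" for w w' :: "nat \<Rightarrow> nat" and b
    using that permutes_not_in[OF p(1), of b]
    by (cases "b \<in> ?B") (auto simp: labeled_states_def PiE_def extensional_def)
  then have "x \<circ> p = x" "z' \<circ> p = z"
    using x z p(2) by (auto simp: fun_eq_iff)
  with p(1) show ?thesis by (rule that)
qed


section \<open>Colourings realising a balanced state\<close>

lemma ex_image_mset_mset_set:
  assumes "finite A" "size M = card A"
  shows "\<exists>f. image_mset f (mset_set A) = M"
  using assms
proof (induction A arbitrary: M rule: finite_induct)
  case (insert b A)
  then obtain a N where M: "M = add_mset a N" "size N = card A"
    by (metis card_insert_disjoint size_eq_Suc_imp_eq_union size_add_mset nat.inject)
  from insert.IH[OF M(2)] obtain f where f: "image_mset f (mset_set A) = N" ..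
  have "image_mset (f(b := a)) (mset_set A) = image_mset f (mset_set A)"
    using insert.hyps by (intro image_mset_cong) auto
  with f M insert.hyps show ?case
    by (intro exI[of _ "f(b := a)"]) (simp del: fun_upd_apply, simp)
qed simp

text \<open>The labeled state stays fixed and the colouring adapts to \<open>y\<close>, so every
  balanced state is an image of any given labeled one.\<close>

lemma ex_colour_state_eq:
  assumes x: "x \<in> labeled_states d n" and y: "y \<in> balanced_states d n"
  obtains \<kappa> where "is_colouring d n \<kappa>" "colour_state d n \<kappa> x = y"
proof -
  have "\<exists>f. image_mset f (mset_set (urn d n x i)) = y i" for i
  proof (rule ex_image_mset_mset_set)
    show "size (y i) = card (urn d n x i)"
      using y card_urn[OF x, of i] urn_outside[OF x, of i]
      by (cases "i \<in> {1..d}") (simp_all add: balanced_states_def)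
  qed simp
  then obtain f where f: "\<And>i. image_mset (f i) (mset_set (urn d n x i)) = y i" by metis
  \<comment> \<open>Each ball lies in one urn only, so the assignments made urn by urn glue
    together.\<close>
  define \<kappa> where "\<kappa> = (\<lambda>b. f (x b) b)"
  have y_eq: "colour_state d n \<kappa> x i = y i" for i
    unfolding colour_state_def f[of i, symmetric]
    by (rule image_mset_cong) (simp add: \<kappa>_def urn_def)
  have "\<kappa> b \<in> {1..d}" if b: "b \<in> {1..d * n}" for b
  proof -
    have "\<kappa> b \<in># colour_state d n \<kappa> x (x b)"
      using b by (simp add: colour_state_def urn_def)
    moreover have "set_mset (y (x b)) \<subseteq> {1..d}"
      using y labeled_states_in_urn[OF x b] by (simp add: balanced_states_def)
    ultimately show ?thesis unfolding y_eq by blast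
  qed
  moreover have "card {b \<in> {1..d * n}. \<kappa> b = a} = n" if a: "a \<in> {1..d}" for a
  proof -
    have "n = (\<Sum>i\<in>{1..d}. count (colour_state d n \<kappa> x i) a)"
      using y a by (simp add: y_eq balanced_states_def)
    also have "\<dots> = (\<Sum>i\<in>{1..d}. card {b \<in> {1..d * n}. x b = i \<and> \<kappa> b = a})"
      by (intro sum.cong refl)
        (auto simp: colour_state_def count_image_mset urn_def intro!: arg_cong[of _ _ card])
    also have "\<dots> = card (\<Union>i\<in>{1..d}. {b \<in> {1..d * n}. x b = i \<and> \<kappa> b = a})"
      by (rule card_UN_disjoint[symmetric]) auto
    also have "(\<Union>i\<in>{1..d}. {b \<in> {1..d * n}. x b = i \<and> \<kappa> b = a}) = {b \<in> {1..d * n}. \<kappa> b = a}"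
      using labeled_states_in_urn[OF x] by auto
    finally show ?thesis by simp
  qed
  ultimately have "is_colouring d n \<kappa>" by (simp add: is_colouring_def)
  with y_eq show ?thesis by (auto intro: that)
qed

text \<open>There are as many colours as urns and \<open>n\<close> balls in each urn, so urn numbers
  can be read as colours.\<close>

lemma labeled_state_is_colouring:
  assumes "x \<in> labeled_states d n"
  shows "is_colouring d n x"
  using assms labeled_states_in_urn[OF assms] by (simp add: is_colouring_def labeled_states_def urn_def)


section \<open>Comparison of the two chains\<close>

context
  fixes d n :: nat and \<mu> :: "(nat \<Rightarrow> nat) pmf"
  assumes n: "n \<ge> 1" and \<mu>: "set_pmf \<mu> \<subseteq> {\<sigma>. \<sigma> permutes {1..d}}"
begin

lemma map_chain_law_colour_state:
  assumes "x \<in> labeled_states d n"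
  shows "map_pmf (colour_state d n \<kappa>) (chain_law (labeled_step d n \<mu>) t x)
    = chain_law (balanced_step d \<mu>) t (colour_state d n \<kappa> x)"
  using set_labeled_step[OF n \<mu>] assms map_labeled_step_colour_state[OF n \<mu>]
  by (rule map_chain_law)

text \<open>The law is equivariant under relabeling, hence invariant under the stabiliser of its
  starting state.\<close>

lemma pmf_chain_law_relabeling:
  assumes p: "p permutes {1..d * n}" and x: "x \<in> labeled_states d n" "x \<circ> p = x"
  shows "pmf (chain_law (labeled_step d n \<mu>) t x) (z \<circ> p)
    = pmf (chain_law (labeled_step d n \<mu>) t x) z"
proof -
  have "map_pmf (\<lambda>x. x \<circ> p) (chain_law (labeled_step d n \<mu>) t x)
      = chain_law (labeled_step d n \<mu>) t (x \<circ> p)"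
    using set_labeled_step[OF n \<mu>] x(1) map_labeled_step_comp_permutes[OF p n]
    by (rule map_chain_law)
  moreover have "inj (\<lambda>x :: nat \<Rightarrow> nat. x \<circ> p)"
    using permutes_inv_o(1)[OF p] by (intro injI) (metis comp_assoc comp_id)
  ultimately show ?thesis
    using pmf_map_inj'[of "\<lambda>x. x \<circ> p" "chain_law (labeled_step d n \<mu>) t x" z] x(2) by simp
qed

text \<open>Projection cannot increase the distance, and every colouring projects the uniform law to
  the same stationary law.\<close>

lemma tv_dist_colour_state_le:
  assumes "x \<in> labeled_states d n" "is_colouring d n \<kappa>"
  shows "tv_dist (chain_law (balanced_step d \<mu>) t (colour_state d n \<kappa> x)) (balanced_stationary d n)
    \<le> tv_dist (chain_law (labeled_step d n \<mu>) t x) (labeled_stationary d n)"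
  using tv_dist_map_le[of "colour_state d n \<kappa>"]
  by (simp add: map_chain_law_colour_state[OF assms(1), symmetric]
      balanced_stationary_eq[OF n assms(2), symmetric])

text \<open>Relabelings fixing \<open>x\<close> act transitively on each fibre of
  \<open>colour_state d n x\<close>, so both laws are constant there.\<close>

lemma tv_dist_colour_by_initial_urn:
  assumes x: "x \<in> labeled_states d n"
  shows "tv_dist (chain_law (balanced_step d \<mu>) t (colour_state d n x x)) (balanced_stationary d n)
    = tv_dist (chain_law (labeled_step d n \<mu>) t x) (labeled_stationary d n)"
proof -
  have "tv_dist (map_pmf (colour_state d n x) (chain_law (labeled_step d n \<mu>) t x))
      (map_pmf (colour_state d n x) (labeled_stationary d n))
    = tv_dist (chain_law (labeled_step d n \<mu>) t x) (labeled_stationary d n)"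
  proof (rule tv_dist_map_sufficient[OF finite_labeled_states])
    show "set_pmf (chain_law (labeled_step d n \<mu>) t x) \<subseteq> labeled_states d n"
      using set_labeled_step[OF n \<mu>] x by (rule set_chain_law)
    show "set_pmf (labeled_stationary d n) \<subseteq> labeled_states d n"
      by (simp add: labeled_stationary_def finite_labeled_states labeled_states_nonempty[OF n])
  next
    fix z z' assume z: "z \<in> labeled_states d n" "z' \<in> labeled_states d n"
      and "colour_state d n x z = colour_state d n x z'"
    then obtain p where "p permutes {1..d * n}" "x \<circ> p = x" "z' \<circ> p = z"
      using colour_state_eq_imp_relabeling[OF x] by metis
    then show "pmf (chain_law (labeled_step d n \<mu>) t x) z = pmf (chain_law (labeled_step d n \<mu>) t x) z'"
      using pmf_chain_law_relabeling x by metis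
    show "pmf (labeled_stationary d n) z = pmf (labeled_stationary d n) z'"
      using z by (simp add: labeled_stationary_def finite_labeled_states labeled_states_nonempty[OF n])
  qed
  then show ?thesis
    by (simp add: map_chain_law_colour_state[OF x]
        balanced_stationary_eq[OF n labeled_state_is_colouring[OF x]])
qed

lemma d_bal_eq_d_lab: "d_bal d n \<mu> t = d_lab d n \<mu> t"
proof -
  let ?lab = "\<lambda>x. tv_dist (chain_law (labeled_step d n \<mu>) t x) (labeled_stationary d n)"
  let ?bal = "\<lambda>y. tv_dist (chain_law (balanced_step d \<mu>) t y) (balanced_stationary d n)"
  note fin = finite_labeled_states[of d n] finite_balanced_states[of d n]
  note ne = labeled_states_nonempty[OF n, of d] balanced_states_nonempty[OF n, of d]
  have "?bal y \<le> Max (?lab ` labeled_states d n)" if y: "y \<in> balanced_states d n" for y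
  proof -
    \<comment> \<open>An arbitrary labeled state will do; the colouring is chosen to fit
      \<open>y\<close>.\<close>
    obtain x where x: "x \<in> labeled_states d n" using ne(1) by blast
    obtain \<kappa> where "is_colouring d n \<kappa>" "colour_state d n \<kappa> x = y"
      using ex_colour_state_eq[OF x y] .
    then have "?bal y \<le> ?lab x" using tv_dist_colour_state_le[OF x] by blast
    also have "\<dots> \<le> Max (?lab ` labeled_states d n)" using fin x by simp
    finally show ?thesis .
  qed
  moreover have "?lab x \<le> Max (?bal ` balanced_states d n)" if x: "x \<in> labeled_states d n" for x
  proof -
    \<comment> \<open>The balanced start used here has urn \<open>i\<close> filled entirely with
      colour \<open>i\<close>.\<close>
    have "?lab x = ?bal (colour_state d n x x)"
      using tv_dist_colour_by_initial_urn[OF x] by simp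
    also have "\<dots> \<le> Max (?bal ` balanced_states d n)"
      using fin colour_state_balanced[OF x labeled_state_is_colouring[OF x]] by simp
    finally show ?thesis .
  qed
  ultimately show ?thesis
    using fin ne unfolding d_bal_def d_lab_def worst_case_tv_def
    by (intro antisym) simp_all
qed

end

theorem lemma1p6:
  fixes d n :: nat and \<mu> :: "(nat \<Rightarrow> nat) pmf"
  assumes "d \<ge> 2" and "n \<ge> 1"
    and "set_pmf \<mu> \<subseteq> {\<sigma>. \<sigma> permutes {1..d}}"
    and "irreducible_matrix d (single_ball_matrix \<mu>)"
  shows "\<forall>t\<ge>0. d_bal d n \<mu> t = d_lab d n \<mu> t"
  using d_bal_eq_d_lab[OF assms(2,3)] by blast

end
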